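(* Let $X$ be a reflexive Banach space and let $f\colon X\to\mathbb{R}$ be strongly quasiconvex and lower semicontinuous. Then $\operatorname{prox}_f(v)$ is nonempty for all $v\in X$.
   Context: All normed vector spaces are real and nontrivial. A function $f\colon X\to\mathbb{R}$ is strongly quasiconvex if there is $\sigma>0$ with $f(\lambda x+(1-\lambda)y)\le\max\{f(x),f(y)\}-\frac{\sigma}{2}\lambda(1-\lambda)\|x-y\|^2$ for all $x,y\in X$ and $0<\lambda<1$. For $v\in X$, $\operatorname{prox}_f(v)=\operatorname{argmin}_{x\in X}\left(f(x)+\frac12\|x-v\|^2\right)$ is the set of all minimizers over $X$ of $x\mapsto f(x)+\frac12\|x-v\|^2$ (empty if there is no minimizer). *)

theory Defs
  imports "HOL-Analysis.Analysis"
begin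

text \<open>The topological dual of a real normed space \<open>'a\<close> is the type \<open>'a \<Rightarrow>\<^sub>L real\<close>
  of bounded linear functionals with the operator norm.\<close>

lift_definition canonical_embedding ::
    "'a::real_normed_vector \<Rightarrow> (('a \<Rightarrow>\<^sub>L real) \<Rightarrow>\<^sub>L real)"
  is "\<lambda>x \<phi>. blinfun_apply \<phi> x"
  by (rule blinfun.bounded_linear_left)

definition reflexive_space :: "'a::real_normed_vector itself \<Rightarrow> bool" where
  "reflexive_space _ \<longleftrightarrow> surj (canonical_embedding :: 'a \<Rightarrow> (('a \<Rightarrow>\<^sub>L real) \<Rightarrow>\<^sub>L real))"

definition strongly_quasiconvex :: "('a::real_normed_vector \<Rightarrow> real) \<Rightarrow> bool" where
  "strongly_quasiconvex f \<longleftrightarrow>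
     (\<exists>\<sigma>>0. \<forall>x y. \<forall>t::real. 0 < t \<and> t < 1 \<longrightarrow>
        f (t *\<^sub>R x + (1 - t) *\<^sub>R y)
          \<le> max (f x) (f y) - \<sigma> / 2 * t * (1 - t) * (norm (x - y))\<^sup>2)"

definition lower_semicontinuous :: "('a::topological_space \<Rightarrow> real) \<Rightarrow> bool" where
  "lower_semicontinuous f \<longleftrightarrow>
     (\<forall>x. \<forall>c < f x. eventually (\<lambda>z. c < f z) (nhds x))"

definition prox :: "('a::real_normed_vector \<Rightarrow> real) \<Rightarrow> 'a \<Rightarrow> 'a set" where
  "prox f v = {x. is_arg_min (\<lambda>x. f x + 1 / 2 * (norm (x - v))\<^sup>2) (\<lambda>_. True) x}"

end

theory Submission
  imports Defs
begin

text \<open>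
  A strongly quasiconvex function that is bounded below on one ball has a bounded sublevel set.
  Reflexivity enters only through Smulian's theorem (nested bounded closed convex sets meet), which
  gives lower bounds on bounded sets. The sum \<open>f x + \<parallel>x - v\<parallel>\<^sup>2 / 2\<close> need not be quasiconvex, so along
  a minimizing sequence the two summands are made to converge separately, to \<open>a\<close> and \<open>r\<^sup>2 / 2\<close>;
  Smulian's theorem then yields a common point of the sets
  \<open>{f \<le> a + \<epsilon>} \<inter> cball v (r + \<epsilon>)\<close>. Both Hahn-Banach and the separation theorem behind Smulian's
  theorem come from tilting a sublinear functional along a convex set: a minimal sublinear functional
  cannot be lowered by a tilt along any vector, so it is odd, hence linear.
\<close>

section \<open>Sublinear functionals: tilting and infima of chains\<close>

definition sublinear :: "('a::real_vector \<Rightarrow> real) \<Rightarrow> bool" where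
  "sublinear p \<longleftrightarrow> (\<forall>x y. p (x + y) \<le> p x + p y) \<and> (\<forall>c>0. \<forall>x. p (c *\<^sub>R x) \<le> c * p x)"

lemma sublinearD:
  assumes "sublinear p"
  shows "p (x + y) \<le> p x + p y" and "c > 0 \<Longrightarrow> p (c *\<^sub>R x) \<le> c * p x"
  using assms by (auto simp: sublinear_def)

lemma sublinear_zero:
  assumes "sublinear p"
  shows "p 0 = 0"
  using sublinearD(2)[OF assms, of 2 0] sublinearD(2)[OF assms, of "1/2" 0] by simp

text \<open>Applying the inequality with factor \<open>inverse c\<close> at
  \<open>c *\<^sub>R x\<close> reverses it. The definition can therefore ask for
  \<open>\<le>\<close> only, which is the form that infima of functionals deliver directly.\<close>

lemma sublinear_scaleR:
  assumes p: "sublinear p" and c: "c \<ge> 0"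
  shows "p (c *\<^sub>R x) = c * p x"
proof (cases "c = 0")
  case True
  then show ?thesis by (simp add: sublinear_zero[OF p])
next
  case False
  with c have c: "c > 0" by simp
  have "p (inverse c *\<^sub>R (c *\<^sub>R x)) \<le> inverse c * p (c *\<^sub>R x)"
    using c by (intro sublinearD(2)[OF p]) simp
  with c have "c * p x \<le> p (c *\<^sub>R x)" by (simp add: field_simps)
  with sublinearD(2)[OF p c, of x] show ?thesis by simp
qed

lemma sublinear_lower:
  assumes "sublinear p"
  shows "- p (- x) \<le> p x"
  using sublinearD(1)[OF assms, of x "- x"] sublinear_zero[OF assms] by simp

text \<open>Take for \<open>r z\<close> the infimum of \<open>q (z + l *\<^sub>R k) - d * l\<close>
  over \<open>l \<ge> 0\<close> and \<open>k \<in> K\<close>: the choice \<open>l = 0\<close> gives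
  \<open>r \<le> q\<close>, and \<open>l = 1\<close> at \<open>- k\<close> gives \<open>- d\<close>.
  A singleton \<open>K\<close> will yield oddness in Hahn-Banach; the set of all
  \<open>x - c\<close> with \<open>c \<in> C\<close>, with the norm as \<open>q\<close>, will yield
  separation.\<close>

lemma sublinear_tilt:
  fixes q :: "'a::real_vector \<Rightarrow> real"
  assumes q: "sublinear q" and K: "convex K" "K \<noteq> {}" and d: "\<And>k. k \<in> K \<Longrightarrow> d \<le> q k"
  obtains r where "sublinear r" "\<And>z. r z \<le> q z" "\<And>k. k \<in> K \<Longrightarrow> r (- k) \<le> - d"
proof -
  define A where "A z = {q (z + l *\<^sub>R k) - d * l | l k. l \<ge> 0 \<and> k \<in> K}" for z
  define r where "r z = Inf (A z)" for z
  obtain k0 where k0: "k0 \<in> K" using K by blast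
  \<comment> \<open>This is where \<open>d \<le> q k\<close> enters: the gain \<open>d * l\<close>
    is at most \<open>q (l *\<^sub>R k)\<close>, which subadditivity splits into
    \<open>q (- z)\<close> and \<open>q (z + l *\<^sub>R k)\<close>. Hence the infimum is
    finite.\<close>
  have low: "- q (- z) \<le> s" if s: "s \<in> A z" for s z
  proof -
    from s obtain l k where lk: "l \<ge> 0" "k \<in> K" "s = q (z + l *\<^sub>R k) - d * l"
      by (auto simp: A_def)
    have "l * d \<le> l * q k" using lk d by (intro mult_left_mono) auto
    also have "\<dots> = q (- z + (z + l *\<^sub>R k))" using lk sublinear_scaleR[OF q] by simp
    also have "\<dots> \<le> q (- z) + q (z + l *\<^sub>R k)" by (rule sublinearD(1)[OF q])
    finally show ?thesis using lk by (simp add: algebra_simps)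
  qed
  have bdd: "bdd_below (A z)" for z using low by (meson bdd_belowI)
  have ne: "A z \<noteq> {}" for z
  proof -
    have "q (z + 0 *\<^sub>R k0) - d * 0 \<in> A z" using k0 unfolding A_def by blast
    then show ?thesis by blast
  qed
  have le: "r z \<le> q (z + l *\<^sub>R k) - d * l" if "l \<ge> 0" "k \<in> K" for z l k
    unfolding r_def using that by (intro cInf_lower bdd) (auto simp: A_def)
  have "r (x + y) \<le> s + t" if s: "s \<in> A x" and t: "t \<in> A y" for x y s t
  proof -
    from s obtain l k where lk: "l \<ge> 0" "k \<in> K" "s = q (x + l *\<^sub>R k) - d * l"
      by (auto simp: A_def)
    from t obtain m h where mh: "m \<ge> 0" "h \<in> K" "t = q (y + m *\<^sub>R h) - d * m"
      by (auto simp: A_def)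
    \<comment> \<open>Convexity merges the two shifts into one multiple of a single point of
      \<open>K\<close>: \<open>g\<close> is the mean of \<open>k\<close> and \<open>h\<close> with
      weights proportional to \<open>l\<close> and \<open>m\<close>. If both are zero, any point of
      \<open>K\<close> serves.\<close>
    obtain g where g: "g \<in> K" "(l + m) *\<^sub>R g = l *\<^sub>R k + m *\<^sub>R h"
    proof (cases "l + m = 0")
      case True
      then have "l = 0" "m = 0" using lk mh by auto
      then show ?thesis using that[OF k0] by simp
    next
      case False
      then have lm: "l + m > 0" using lk mh by simp
      have "(l / (l + m)) *\<^sub>R k + (m / (l + m)) *\<^sub>R h \<in> K"
        using lm lk mh by (intro convexD[OF K(1)]) (auto simp: add_divide_distrib[symmetric])
      then show ?thesis using lm by (intro that) (auto simp: scaleR_add_right)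
    qed
    have "r (x + y) \<le> q (x + y + (l + m) *\<^sub>R g) - d * (l + m)"
      using lk mh g by (intro le) auto
    also have "x + y + (l + m) *\<^sub>R g = (x + l *\<^sub>R k) + (y + m *\<^sub>R h)"
      unfolding g by simp
    also have "q \<dots> - d * (l + m) \<le> s + t"
      using sublinearD(1)[OF q, of "x + l *\<^sub>R k" "y + m *\<^sub>R h"] lk mh
      by (simp add: algebra_simps)
    finally show ?thesis .
  qed
  \<comment> \<open>The infimum is taken first over \<open>t\<close>, then over \<open>s\<close>,
    each time with the other term moved to the left.\<close>
  then have "r (x + y) - s \<le> t" if "s \<in> A x" "t \<in> A y" for x y s t
    using that by (simp only: diff_le_eq add.commute[of t])
  then have "r (x + y) - s \<le> r y" if "s \<in> A x" for x y s
    unfolding r_def[of y] using that by (intro cInf_greatest ne)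
  then have "r (x + y) - r y \<le> s" if "s \<in> A x" for x y s
    using that by (simp only: diff_le_eq add.commute[of s])
  then have "r (x + y) - r y \<le> r x" for x y
    unfolding r_def[of x] by (intro cInf_greatest ne)
  then have add: "r (x + y) \<le> r x + r y" for x y by (simp add: algebra_simps)
  have "r (c *\<^sub>R x) \<le> c * s" if c: "c > 0" and s: "s \<in> A x" for c x s
  proof -
    from s obtain l k where lk: "l \<ge> 0" "k \<in> K" "s = q (x + l *\<^sub>R k) - d * l"
      by (auto simp: A_def)
    have "r (c *\<^sub>R x) \<le> q (c *\<^sub>R x + (c * l) *\<^sub>R k) - d * (c * l)"
      using lk c by (intro le) auto
    also have "c *\<^sub>R x + (c * l) *\<^sub>R k = c *\<^sub>R (x + l *\<^sub>R k)" by (simp add: scaleR_add_right)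
    also have "q \<dots> = c * q (x + l *\<^sub>R k)" using c sublinear_scaleR[OF q] by simp
    finally show ?thesis unfolding lk(3) by (simp add: algebra_simps)
  qed
  then have "r (c *\<^sub>R x) / c \<le> s" if "c > 0" "s \<in> A x" for c x s
    using that by (simp add: pos_divide_le_eq mult.commute[of s])
  then have "r (c *\<^sub>R x) / c \<le> r x" if "c > 0" for c x
    unfolding r_def[of x] using that by (intro cInf_greatest ne)
  then have "r (c *\<^sub>R x) \<le> c * r x" if "c > 0" for c x
    using that by (simp add: field_simps)
  with add have "sublinear r" by (simp add: sublinear_def)
  moreover have "r z \<le> q z" for z using le[of 0 k0 z] k0 by simp
  moreover have "r (- k) \<le> - d" if "k \<in> K" for k
    using le[of 1 k "- k"] that sublinear_zero[OF q] by simp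
  ultimately show ?thesis by (rule that)
qed

text \<open>Subadditivity can fail for an infimum of arbitrary sublinear functionals. In a chain,
  any \<open>q\<close> and \<open>r\<close> have a member \<open>s\<close> below both, so
  \<open>s (x + y) \<le> s x + s y \<le> q x + r y\<close>, and the infima over \<open>q\<close> and
  \<open>r\<close> can be taken separately.\<close>

lemma sublinear_Inf_chain:
  fixes C :: "('a::real_vector \<Rightarrow> real) set"
  assumes sub: "\<And>q. q \<in> C \<Longrightarrow> sublinear q" and ne: "C \<noteq> {}"
    and chain: "\<And>q r. q \<in> C \<Longrightarrow> r \<in> C \<Longrightarrow> q \<le> r \<or> r \<le> q"
    and low: "\<And>z. bdd_below ((\<lambda>q. q z) ` C)"
  shows "sublinear (\<lambda>z. INF q\<in>C. q z)"
proof -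
  let ?m = "\<lambda>z. INF q\<in>C. q z"
  have le: "?m z \<le> q z" if "q \<in> C" for q z using that low by (intro cINF_lower)
  have "?m (x + y) \<le> q x + r y" if qr: "q \<in> C" "r \<in> C" for x y q r
  proof -
    obtain s where s: "s \<in> C" "s \<le> q" "s \<le> r" using chain[OF qr] qr by blast
    have "?m (x + y) \<le> s (x + y)" by (rule le[OF s(1)])
    also have "\<dots> \<le> s x + s y" by (rule sublinearD(1)[OF sub[OF s(1)]])
    also have "\<dots> \<le> q x + r y" using s by (intro add_mono) (auto simp: le_fun_def)
    finally show ?thesis .
  qed
  then have "?m (x + y) - q x \<le> r y" if "q \<in> C" "r \<in> C" for x y q r
    using that by (simp only: diff_le_eq add.commute[of "r y"])
  then have "?m (x + y) - q x \<le> ?m y" if "q \<in> C" for x y q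
    using that by (intro cINF_greatest ne)
  then have "?m (x + y) - ?m y \<le> q x" if "q \<in> C" for x y q
    using that by (simp only: diff_le_eq add.commute[of "q x"])
  then have "?m (x + y) - ?m y \<le> ?m x" for x y by (intro cINF_greatest ne)
  moreover have "?m (c *\<^sub>R x) / c \<le> ?m x" if c: "c > 0" for c x
  proof (intro cINF_greatest ne)
    fix q assume q: "q \<in> C"
    show "?m (c *\<^sub>R x) / c \<le> q x"
      using le[OF q, of "c *\<^sub>R x"] sublinearD(2)[OF sub[OF q] c, of x] c by (simp add: field_simps)
  qed
  ultimately show ?thesis by (simp add: sublinear_def field_simps)
qed

section \<open>Hahn-Banach through minimal sublinear functionals\<close>

theorem Hahn_Banach_sublinear:
  fixes p :: "'a::real_vector \<Rightarrow> real"
  assumes p: "sublinear p"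
  obtains L where "linear L" "\<And>x. L x \<le> p x"
proof -
  define S where "S = {q. sublinear q \<and> q \<le> p}"
  have pS: "p \<in> S" using p by (simp add: S_def)
  have "\<exists>m\<in>S. \<forall>a\<in>S. a \<le> m \<longrightarrow> a = m"
  \<comment> \<open>The order is reversed: upper bounds of chains are pointwise infima, and a
    maximal element is a minimal functional.\<close>
  proof (rule predicate_Zorn[where P = "\<lambda>a b. b \<le> a"])
    show "partial_order_on S (relation_of (\<lambda>a b. b \<le> a) S)"
      by (intro partial_order_on_relation_ofI) auto
  next
    fix C assume C: "C \<in> Chains (relation_of (\<lambda>a b. b \<le> a) S)"
    have CS: "C \<subseteq> S" using C by (auto simp: Chains_def relation_of_def)
    show "\<exists>u\<in>S. \<forall>a\<in>C. u \<le> a"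
    proof (cases "C = {}")
      case True
      then show ?thesis using pS by auto
    next
      case False
      then obtain q0 where q0: "q0 \<in> C" by blast
      have sub: "sublinear q" if "q \<in> C" for q using that CS by (auto simp: S_def)
      \<comment> \<open>Every sublinear \<open>q \<le> p\<close> satisfies
        \<open>- p (- z) \<le> - q (- z) \<le> q z\<close>, a lower bound common to the whole
        chain.\<close>
      have low: "bdd_below ((\<lambda>q. q z) ` C)" for z
      proof (rule bdd_belowI2)
        fix q assume q: "q \<in> C"
        then have "q (- z) \<le> p (- z)" using CS by (auto simp: S_def le_fun_def)
        then show "- p (- z) \<le> q z" using sublinear_lower[OF sub[OF q], of z] by simp
      qed
      have "sublinear (\<lambda>z. INF q\<in>C. q z)"
        using C by (intro sublinear_Inf_chain sub False low) (auto simp: Chains_def relation_of_def)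
      moreover have le: "(\<lambda>z. INF q\<in>C. q z) \<le> q" if "q \<in> C" for q
        using that low by (auto simp: le_fun_def intro: cINF_lower)
      moreover have "(\<lambda>z. INF q\<in>C. q z) \<le> p"
        using le[OF q0] q0 CS by (auto simp: S_def)
      ultimately show ?thesis by (auto simp: S_def)
    qed
  qed
  then obtain m where m: "m \<in> S" and min: "\<And>a. a \<in> S \<Longrightarrow> a \<le> m \<Longrightarrow> a = m" by blast
  have sm: "sublinear m" and mp: "\<And>x. m x \<le> p x" using m by (auto simp: S_def le_fun_def)
  have odd: "m (- y) = - m y" for y
  proof -
    \<comment> \<open>The tilt along \<open>y\<close> with the largest admissible \<open>d\<close>,
      namely \<open>m y\<close>, lies below \<open>m\<close>, so by minimality it equals
      \<open>m\<close>; this gives \<open>m (- y) \<le> - m y\<close>.\<close>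
    obtain r where r: "sublinear r" "\<And>z. r z \<le> m z" "r (- y) \<le> - m y"
      using sublinear_tilt[OF sm, of "{y}" "m y"] by auto
    have "r = m" using r m by (intro min) (auto simp: S_def le_fun_def intro: order_trans)
    with r(3) sublinear_lower[OF sm, of y] show ?thesis by simp
  qed
  have "linear m"
  proof (rule linearI)
    fix x y
    \<comment> \<open>Subadditivity at the negated vectors becomes superadditivity by
      oddness.\<close>
    have "m (- x + - y) \<le> m (- x) + m (- y)" by (rule sublinearD(1)[OF sm])
    then have "m x + m y \<le> m (x + y)" using odd[of "x + y"] odd by simp
    with sublinearD(1)[OF sm, of x y] show "m (x + y) = m x + m y" by simp
  next
    fix c x
    show "m (c *\<^sub>R x) = c *\<^sub>R m x"
    proof (cases "c \<ge> 0")
      case True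
      then show ?thesis by (simp add: sublinear_scaleR[OF sm])
    next
      case False
      then show ?thesis using sublinear_scaleR[OF sm, of "- c" x] odd[of "c *\<^sub>R x"] by simp
    qed
  qed
  then show ?thesis using mp by (rule that)
qed

section \<open>Separation and nested convex sets in reflexive spaces\<close>

lemma linear_le_norm_imp_bounded_linear:
  fixes L :: "'a::real_normed_vector \<Rightarrow> real"
  assumes L: "linear L" and le: "\<And>x. L x \<le> B * norm x"
  shows "bounded_linear L"
proof -
  interpret linear L by (rule L)
  have "norm (L x) \<le> norm x * B" for x
    using le[of x] le[of "- x"] by (simp add: neg abs_le_iff algebra_simps)
  then show ?thesis
    by (intro bounded_linear_intro[of L B]) (simp_all add: add scale)
qed

text \<open>A ball of radius \<open>d\<close> around \<open>x\<close> misses \<open>C\<close>, so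
  the norm is at least \<open>d\<close> on the convex set of all \<open>x - c\<close>. Tilting the
  norm along this set gives a sublinear functional that is at most \<open>- d\<close> on every
  \<open>c - x\<close>; a linear functional below it is bounded by the norm and separates.\<close>

lemma separate_point_closed_convex:
  fixes C :: "'a::real_normed_vector set"
  assumes C: "closed C" "convex C" "C \<noteq> {}" and x: "x \<notin> C"
  obtains \<phi> :: "'a \<Rightarrow>\<^sub>L real" and d
  where "d > 0" "\<And>c. c \<in> C \<Longrightarrow> blinfun_apply \<phi> c + d \<le> blinfun_apply \<phi> x"
proof -
  obtain d where d: "d > 0" "\<And>c. c \<in> C \<Longrightarrow> d \<le> dist x c"
    using C(1) x unfolding closed_def open_contains_ball by (force simp: subset_iff not_less)
  have norm: "sublinear (norm :: 'a \<Rightarrow> real)" by (simp add: sublinear_def norm_triangle_ineq)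
  obtain r :: "'a \<Rightarrow> real" where r: "sublinear r" "\<And>z. r z \<le> norm z"
    "\<And>k. k \<in> (\<lambda>c. x - c) ` C \<Longrightarrow> r (- k) \<le> - d"
  proof (rule sublinear_tilt[OF norm, of "(\<lambda>c. x - c) ` C" d])
    show "convex ((\<lambda>c. x - c) ` C)"
      using convex_translation[OF convex_negations[OF C(2)], of x] by (simp add: image_image)
  qed (use C d in \<open>auto simp: dist_norm\<close>)
  obtain L where L: "linear L" "\<And>z. L z \<le> r z" using Hahn_Banach_sublinear[OF r(1)] by blast
  have "bounded_linear L"
    using L r(2) by (intro linear_le_norm_imp_bounded_linear[of L 1]) (auto intro: order_trans)
  then have app: "blinfun_apply (Blinfun L) = L" by (rule bounded_linear_Blinfun_apply)
  show ?thesis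
  proof (rule that[OF d(1)])
    fix c assume "c \<in> C"
    then have "L (c - x) \<le> - d" using r(3)[of "x - c"] L(2)[of "c - x"] by force
    then show "blinfun_apply (Blinfun L) c + d \<le> blinfun_apply (Blinfun L) x"
      by (simp add: app linear_diff[OF L(1)])
  qed
qed

text \<open>The support functions \<open>s n\<close> of the sets decrease with \<open>n\<close>, so
  their infimum is sublinear on the dual. A linear \<open>L\<close> below it is bounded, and
  reflexivity represents it as evaluation at a point \<open>x\<close>. Then
  \<open>blinfun_apply \<phi> x \<le> s n \<phi>\<close> for all \<open>\<phi>\<close> and
  \<open>n\<close>, so no functional separates \<open>x\<close> from any \<open>C n\<close>.\<close>

theorem reflexive_nested_closed_convex:
  fixes C :: "nat \<Rightarrow> 'a::real_normed_vector set"
  assumes refl: "reflexive_space TYPE('a)"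
    and C: "\<And>n. closed (C n)" "\<And>n. convex (C n)" "\<And>n. C n \<noteq> {}" "bounded (C 0)" "decseq C"
  shows "(\<Inter>n. C n) \<noteq> {}"
proof -
  obtain B where B: "\<And>c. c \<in> C 0 \<Longrightarrow> norm c \<le> B" using C(4) by (auto simp: bounded_iff)
  have mono: "C n \<subseteq> C m" if "m \<le> n" for m n using C(5) that by (auto simp: decseq_def)
  have bound: "norm c \<le> B" if "c \<in> C n" for c n using that B mono[of 0 n] by auto
  have abs: "\<bar>blinfun_apply \<phi> c\<bar> \<le> B * norm \<phi>" if "c \<in> C n" for \<phi> c n
    using norm_blinfun[of \<phi> c] mult_left_mono[OF bound[OF that] norm_ge_zero[of \<phi>]]
    by (simp add: mult.commute)
  have bdd: "bdd_above (blinfun_apply \<phi> ` C n)" for \<phi> :: "'a \<Rightarrow>\<^sub>L real" and n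
    using abs by (intro bdd_aboveI2[where M = "B * norm \<phi>"]) (auto simp: abs_le_iff)
  define s where "s n \<phi> = (SUP c\<in>C n. blinfun_apply \<phi> c)" for n and \<phi> :: "'a \<Rightarrow>\<^sub>L real"
  have s_ub: "blinfun_apply \<phi> c \<le> s n \<phi>" if "c \<in> C n" for \<phi> c n
    unfolding s_def using that bdd by (intro cSUP_upper)
  have s_least: "s n \<phi> \<le> t" if "\<And>c. c \<in> C n \<Longrightarrow> blinfun_apply \<phi> c \<le> t" for n \<phi> t
    unfolding s_def using that C(3) by (intro cSUP_least)
  have s_sub: "sublinear (s n)" for n
    unfolding sublinear_def
  proof (intro conjI allI impI)
    fix \<phi> \<psi> show "s n (\<phi> + \<psi>) \<le> s n \<phi> + s n \<psi>"
      by (intro s_least) (auto simp: blinfun.add_left intro: add_mono s_ub)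
  next
    fix c :: real and \<phi> assume "c > 0"
    then show "s n (c *\<^sub>R \<phi>) \<le> c * s n \<phi>"
      by (intro s_least) (auto simp: blinfun.scaleR_left s_ub)
  qed
  \<comment> \<open>The bound comes from \<open>C 0\<close> and does not depend on \<open>n\<close>,
    so the infimum of the support functions is finite.\<close>
  have s_low: "- (B * norm \<phi>) \<le> s n \<phi>" for n \<phi>
  proof -
    obtain c where c: "c \<in> C n" using C(3) by blast
    with abs[OF c, of \<phi>] s_ub[OF c, of \<phi>] show ?thesis by (simp add: abs_le_iff)
  qed
  have s_up: "s n \<phi> \<le> B * norm \<phi>" for n \<phi>
    using abs by (intro s_least) (auto simp: abs_le_iff)
  have s_mono: "s n \<le> s m" if "m \<le> n" for m n
    unfolding le_fun_def using mono[OF that] by (auto intro!: s_least s_ub)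
  have low: "bdd_below ((\<lambda>q. q \<phi>) ` range s)" for \<phi>
    using s_low by (intro bdd_belowI2[where m = "- (B * norm \<phi>)"]) auto
  have "sublinear (\<lambda>\<phi>. INF q\<in>range s. q \<phi>)"
    using s_sub s_mono low
    by (intro sublinear_Inf_chain) (auto, metis nle_le)
  then obtain L where L: "linear L" "\<And>\<phi>. L \<phi> \<le> (INF q\<in>range s. q \<phi>)"
    using Hahn_Banach_sublinear by blast
  have Ls: "L \<phi> \<le> s n \<phi>" for \<phi> n
    using L(2)[of \<phi>] cINF_lower[OF low, of "s n" \<phi>] by simp
  have "bounded_linear L"
    using linear_le_norm_imp_bounded_linear[OF L(1)] order_trans[OF Ls s_up] by blast
  then have app: "blinfun_apply (Blinfun L) = L" by (rule bounded_linear_Blinfun_apply)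
  obtain x :: 'a where "canonical_embedding x = Blinfun L"
    using refl unfolding reflexive_space_def by (metis surjD)
  then have x: "blinfun_apply \<phi> x = L \<phi>" for \<phi>
    by (metis app canonical_embedding.rep_eq)
  have "x \<in> C n" for n
  proof (rule ccontr)
    assume "x \<notin> C n"
    then obtain \<phi> :: "'a \<Rightarrow>\<^sub>L real" and d
      where d: "d > 0" "\<And>c. c \<in> C n \<Longrightarrow> blinfun_apply \<phi> c + d \<le> blinfun_apply \<phi> x"
      using separate_point_closed_convex[OF C(1-3)] by blast
    have "s n \<phi> \<le> blinfun_apply \<phi> x - d" using d(2) by (intro s_least) (simp add: algebra_simps)
    with Ls[of \<phi> n] d(1) show False by (simp add: x)
  qed
  then show ?thesis by blast
qed

section \<open>Sublevel sets and lower bounds\<close>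

lemma lower_semicontinuous_closed_sublevel:
  assumes "lower_semicontinuous f"
  shows "closed {x. f x \<le> c}"
proof -
  have "open {x. c < f x}"
    using assms by (subst open_subopen) (fastforce simp: lower_semicontinuous_def eventually_nhds)
  then show ?thesis by (simp add: closed_def Collect_neg_eq[symmetric] not_le)
qed

lemma strongly_quasiconvex_convex_sublevel:
  assumes "strongly_quasiconvex f"
  shows "convex {x. f x \<le> c}"
proof -
  obtain \<sigma> where \<sigma>: "\<sigma> > 0" "\<And>x y t. 0 < t \<and> t < 1 \<Longrightarrow> f (t *\<^sub>R x + (1 - t) *\<^sub>R y)
      \<le> max (f x) (f y) - \<sigma> / 2 * t * (1 - t) * (norm (x - y))\<^sup>2"
    using assms unfolding strongly_quasiconvex_def by blast
  show ?thesis
    unfolding convex_def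
  proof (intro ballI allI impI)
    fix x y and u v :: real
    assume x: "x \<in> {x. f x \<le> c}" and y: "y \<in> {x. f x \<le> c}" and uv: "0 \<le> u" "0 \<le> v" "u + v = 1"
    show "u *\<^sub>R x + v *\<^sub>R y \<in> {x. f x \<le> c}"
    proof (cases "0 < u \<and> u < 1")
      case True
      have v: "v = 1 - u" using uv by simp
      have "0 \<le> \<sigma> / 2 * u * (1 - u) * (norm (x - y))\<^sup>2" using \<sigma>(1) True by simp
      then show ?thesis using \<sigma>(2)[OF True, of x y] x y unfolding v by simp
    next
      case False
      then have "u = 0 \<and> v = 1 \<or> u = 1 \<and> v = 0" using uv by auto
      then show ?thesis using x y by auto
    qed
  qed
qed

text \<open>Were \<open>f\<close> unbounded below on \<open>S\<close>, the sets
  \<open>S \<inter> {x. f x \<le> - real n}\<close> would be nonempty and nested, and a common point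
  would have a value below every \<open>- real n\<close>.\<close>

lemma reflexive_bdd_below:
  fixes f :: "'a::real_normed_vector \<Rightarrow> real"
  assumes refl: "reflexive_space TYPE('a)"
    and f: "\<And>c. closed {x. f x \<le> c}" "\<And>c. convex {x. f x \<le> c}"
    and S: "closed S" "convex S" "bounded S"
  shows "bdd_below (f ` S)"
proof (rule ccontr)
  assume unb: "\<not> bdd_below (f ` S)"
  define C where "C n = S \<inter> {x. f x \<le> - real n}" for n
  have "(\<Inter>n. C n) \<noteq> {}"
  proof (rule reflexive_nested_closed_convex[OF refl])
    show "C n \<noteq> {}" for n
    proof
      assume "C n = {}"
      then have "\<forall>x\<in>S. - real n \<le> f x" by (force simp: C_def)
      with unb show False by (meson bdd_belowI2)
    qed
  qed (use f S in \<open>auto simp: C_def decseq_def closed_Int convex_Int bounded_Int\<close>)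
  then obtain x where x: "\<And>n. f x \<le> - real n" by (auto simp: C_def)
  obtain n where "- f x < real n" using reals_Archimedean2 by blast
  with x[of n] show False by simp
qed

text \<open>On the segment from \<open>x0\<close> to a far point \<open>y\<close> of the sublevel
  set, at distance \<open>R\<close>, the point at distance 1 from \<open>x0\<close> has value at
  most \<open>f x0 - \<sigma> / 2 * (R - 1)\<close>. The lower bound \<open>m\<close> on the unit
  ball therefore limits \<open>R\<close>.\<close>

lemma strongly_quasiconvex_bounded_sublevel:
  assumes f: "strongly_quasiconvex f" and bdd: "bdd_below (f ` cball x0 1)"
  shows "bounded {x. f x \<le> f x0}"
proof -
  obtain \<sigma> where \<sigma>: "\<sigma> > 0" "\<And>x y t. 0 < t \<and> t < 1 \<Longrightarrow> f (t *\<^sub>R x + (1 - t) *\<^sub>R y)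
      \<le> max (f x) (f y) - \<sigma> / 2 * t * (1 - t) * (norm (x - y))\<^sup>2"
    using f unfolding strongly_quasiconvex_def by blast
  obtain m where m: "\<And>x. x \<in> cball x0 1 \<Longrightarrow> m \<le> f x" using bdd by (auto simp only: bdd_below_def ball_simps)
  have "dist x0 y \<le> 1 + 2 * (f x0 - m) / \<sigma>" if y: "f y \<le> f x0" for y
  proof (cases "norm (y - x0) \<le> 1")
    case True
    have "0 \<le> 2 * (f x0 - m) / \<sigma>" using m[of x0] \<sigma>(1) by simp
    moreover have "dist x0 y \<le> 1" using True by (simp add: dist_norm norm_minus_commute)
    ultimately show ?thesis by linarith
  next
    case False
    define R where "R = norm (y - x0)"
    \<comment> \<open>This weight places the convex combination on the unit sphere around
      \<open>x0\<close>.\<close>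
    define t where "t = 1 / R"
    have R: "R > 1" using False by (simp add: R_def)
    have t: "0 < t \<and> t < 1" using R by (simp add: t_def)
    have "t *\<^sub>R y + (1 - t) *\<^sub>R x0 - x0 = t *\<^sub>R (y - x0)" by (simp add: algebra_simps)
    then have "norm (t *\<^sub>R y + (1 - t) *\<^sub>R x0 - x0) = 1"
      using R by (simp add: t_def flip: R_def)
    then have "m \<le> f (t *\<^sub>R y + (1 - t) *\<^sub>R x0)"
      by (intro m) (simp add: dist_norm norm_minus_commute)
    also have "\<dots> \<le> f x0 - \<sigma> / 2 * t * (1 - t) * R\<^sup>2"
      using \<sigma>(2)[OF t, of y x0] y by (simp add: R_def max_def split: if_splits)
    also have "\<sigma> / 2 * t * (1 - t) * R\<^sup>2 = \<sigma> / 2 * (R - 1)"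
      using R by (simp add: t_def field_simps power2_eq_square)
    finally have "R \<le> 1 + 2 * (f x0 - m) / \<sigma>" using \<sigma>(1) by (simp add: field_simps)
    then show ?thesis by (simp add: R_def dist_norm norm_minus_commute)
  qed
  then show ?thesis unfolding bounded_def by blast
qed

section \<open>Existence of a proximal point\<close>

theorem corollary5p2:
  fixes f :: "'a::banach \<Rightarrow> real"
  assumes "\<exists>x::'a. x \<noteq> 0"
    and "reflexive_space TYPE('a)"
    and "strongly_quasiconvex f"
    and "lower_semicontinuous f"
  shows "\<forall>v. prox f v \<noteq> {}"
proof
  fix v :: 'a
  note refl = assms(2)
  note closed = lower_semicontinuous_closed_sublevel[OF assms(4)]
  note convex = strongly_quasiconvex_convex_sublevel[OF assms(3)]
  note bdd = reflexive_bdd_below[OF refl closed convex]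
  \<comment> \<open>The lower bound on bounded sets is used twice: on the unit ball around
    \<open>v\<close>, which makes this sublevel set bounded, and then on the sublevel set itself.
    Elsewhere \<open>f\<close> exceeds \<open>f v\<close>, so \<open>f\<close> is bounded below
    globally.\<close>
  have "bounded {x. f x \<le> f v}"
    by (intro strongly_quasiconvex_bounded_sublevel[OF assms(3)] bdd) auto
  then have "bdd_below (f ` {x. f x \<le> f v})" using closed convex by (intro bdd)
  then obtain m0 where "\<And>x. f x \<le> f v \<Longrightarrow> m0 \<le> f x" by (auto simp: bdd_below_def)
  then have m: "min m0 (f v) \<le> f x" for x by (cases "f x \<le> f v") fastforce+
  define m where "m = min m0 (f v)"
  define g where "g x = f x + 1 / 2 * (norm (x - v))\<^sup>2" for x
  define I where "I = Inf (range g)"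
  have gm: "m + 1 / 2 * (norm (x - v))\<^sup>2 \<le> g x" for x using m by (simp add: g_def m_def)
  have "m \<le> g x" for x
    using gm[of x] zero_le_power2[of "norm (x - v)"] by linarith
  then have gbdd: "bdd_below (range g)" by (meson bdd_belowI2)
  have I: "I \<le> g x" for x unfolding I_def by (intro cInf_lower gbdd) auto
  have "\<exists>x. g x < I + 1 / real (Suc n)" for n
    using cInf_lessD[of "range g" "I + 1 / real (Suc n)"] by (auto simp: I_def)
  then obtain X where X: "\<And>n. g (X n) < I + 1 / real (Suc n)" by metis
  have gX: "(\<lambda>n. g (X n)) \<longlonglongrightarrow> I"
  proof (rule tendsto_sandwich[of "\<lambda>_. I" _ _ "\<lambda>n. I + 1 / real (Suc n)"])
    show "(\<lambda>n. I + 1 / real (Suc n)) \<longlonglongrightarrow> I"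
      using tendsto_add[OF tendsto_const LIMSEQ_Suc[OF lim_const_over_n[of 1]], of I] by simp
  qed (use I X in \<open>auto intro: always_eventually less_imp_le\<close>)
  \<comment> \<open>Since \<open>f \<ge> m\<close>, values of \<open>g\<close> below
    \<open>I + 1\<close> bound the quadratic term; \<open>t \<le> 1 + t\<^sup>2\<close> turns this
    into a bound on the norm.\<close>
  have "norm (X n - v) \<le> 1 + 2 * (I + 1 - m)" for n
  proof -
    have "1 / real (Suc n) \<le> 1" by simp
    with X[of n] have "g (X n) < I + 1" by (rule less_le_trans[OF _ add_left_mono])
    then have "(norm (X n - v))\<^sup>2 \<le> 2 * (I + 1 - m)" using gm[of "X n"] by (simp add: field_simps)
    moreover have "norm (X n - v) \<le> 1 + (norm (X n - v))\<^sup>2"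
      using self_le_power[of "norm (X n - v)" 2] zero_le_power2[of "norm (X n - v)"]
      by (cases "1 \<le> norm (X n - v)") linarith+
    ultimately show ?thesis by linarith
  qed
  then have "bounded (range (\<lambda>n. norm (X n - v)))" by (intro boundedI) auto
  then obtain r \<rho> where \<rho>: "strict_mono \<rho>" "((\<lambda>n. norm (X n - v)) \<circ> \<rho>) \<longlonglongrightarrow> r"
    using bounded_imp_convergent_subsequence by blast
  define Y where "Y n = X (\<rho> n)" for n
  have nY: "(\<lambda>n. norm (Y n - v)) \<longlonglongrightarrow> r" using \<rho>(2) by (simp add: Y_def o_def)
  have gY: "(\<lambda>n. g (Y n)) \<longlonglongrightarrow> I"
    using LIMSEQ_subseq_LIMSEQ[OF gX \<rho>(1)] by (simp add: Y_def o_def)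
  \<comment> \<open>With distances tending to \<open>r\<close> and \<open>g (Y n)\<close> to
    \<open>I\<close>, this is the limit left for \<open>f (Y n)\<close>.\<close>
  define a where "a = I - 1 / 2 * r\<^sup>2"
  have "(\<lambda>n. g (Y n) - 1 / 2 * (norm (Y n - v))\<^sup>2) \<longlonglongrightarrow> a"
    unfolding a_def by (intro tendsto_intros gY nY)
  then have fY: "(\<lambda>n. f (Y n)) \<longlonglongrightarrow> a" by (simp add: g_def)
  \<comment> \<open>The slack \<open>1 / real (Suc n)\<close> is positive for every
    \<open>n\<close>, so each set contains a tail of \<open>Y\<close>. As it shrinks to 0, a common
    point has \<open>f x \<le> a\<close> and distance at most \<open>r\<close> from
    \<open>v\<close>, hence \<open>g x \<le> a + r\<^sup>2 / 2 = I\<close>.\<close>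
  define C where "C n = {x. f x \<le> a + 1 / real (Suc n)} \<inter> cball v (r + 1 / real (Suc n))" for n
  have "(\<Inter>n. C n) \<noteq> {}"
  proof (rule reflexive_nested_closed_convex[OF refl])
    show "C n \<noteq> {}" for n
    proof -
      have "eventually (\<lambda>k. f (Y k) < a + 1 / real (Suc n)) sequentially"
        by (rule order_tendstoD[OF fY]) simp
      moreover have "eventually (\<lambda>k. norm (Y k - v) < r + 1 / real (Suc n)) sequentially"
        by (rule order_tendstoD[OF nY]) simp
      ultimately have "eventually (\<lambda>k. Y k \<in> C n) sequentially"
        by eventually_elim (simp add: C_def dist_norm norm_minus_commute)
      then show ?thesis using eventually_happens[of _ sequentially] by fastforce
    qed
    show "decseq C"
    proof (rule decseq_SucI)
      fix n
      have "1 / real (Suc (Suc n)) \<le> 1 / real (Suc n)" by (intro divide_left_mono) auto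
      then show "C (Suc n) \<subseteq> C n" unfolding C_def by (auto simp del: of_nat_Suc)
    qed
  qed (auto simp: C_def intro!: closed_Int convex_Int closed convex)
  then obtain x where x: "\<And>n. x \<in> C n" by blast
  have lim: "(\<lambda>n. b + 1 / real (Suc n)) \<longlonglongrightarrow> b" for b
    using tendsto_add[OF tendsto_const LIMSEQ_Suc[OF lim_const_over_n[of 1]], of b] by simp
  have "f x \<le> a"
    using x by (intro LIMSEQ_le_const[OF lim]) (auto simp: C_def simp del: of_nat_Suc)
  moreover have "norm (x - v) \<le> r"
    using x by (intro LIMSEQ_le_const[OF lim])
      (auto simp: C_def dist_norm norm_minus_commute simp del: of_nat_Suc)
  then have "(norm (x - v))\<^sup>2 \<le> r\<^sup>2" by (intro power_mono) auto
  ultimately have "g x \<le> I" by (simp add: g_def a_def)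
  then have "x \<in> prox f v"
    using I by (force simp: prox_def is_arg_min_def g_def not_less intro: order_trans)
  then show "prox f v \<noteq> {}" by blast
qed

end
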